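(* If $\mathsf{GP}(\mathsf{all})$ holds, then $\mathcal{SN} = \mathcal{NA}$.
   Context: $\mathsf{GP}(\mathsf{all})$: for every family $\langle A_x : x\in\omega^\omega\rangle$ of Lebesgue null subsets of $2^\omega$ with $x\le x'$ (pointwise) implying $A_x\subseteq A_{x'}$, the union $\bigcup_x A_x$ is Lebesgue null. $\mathcal{SN}$ is the ideal of strong measure zero subsets of $2^\omega$ (with its standard metric): $X\in\mathcal{SN}$ iff for every sequence $\langle\varepsilon_n\rangle$ of positive reals there are sets $C_n$ with $\mathrm{diam}(C_n)<\varepsilon_n$ and $X\subseteq\bigcup_nC_n$. $\mathcal{NA}$ is the null-additive ideal: $X\in\mathcal{NA}$ iff $X+N$ is Lebesgue null for every Lebesgue null $N\subseteq2^\omega$, where $+$ is coordinatewise addition mod $2$. *)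

theory Defs
  imports "HOL-Probability.Probability"
begin

type_synonym cantor = "nat \<Rightarrow> bool"

definition cantor_measure :: "cantor measure" where
  "cantor_measure = (\<Pi>\<^sub>M n\<in>UNIV. measure_pmf (bernoulli_pmf (1/2)))"

text \<open>The product measure lives on the Borel sets only. Lebesgue null sets are taken with respect
  to its completion, so that arbitrary subsets of Borel null sets are included.\<close>

definition lebesgue_null :: "cantor set set" where
  "lebesgue_null = null_sets (completion cantor_measure)"

text \<open>The order on \<^typ>\<open>nat \<Rightarrow> nat\<close> is the library's pointwise order on functions.\<close>

definition GP_all :: bool where
  "GP_all \<longleftrightarrow> (\<forall>A :: (nat \<Rightarrow> nat) \<Rightarrow> cantor set.
     (\<forall>x. A x \<in> lebesgue_null) \<longrightarrow> (\<forall>x x'. x \<le> x' \<longrightarrow> A x \<subseteq> A x') \<longrightarrow>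
     (\<Union>x. A x) \<in> lebesgue_null)"

definition cantor_dist :: "cantor \<Rightarrow> cantor \<Rightarrow> real" where
  "cantor_dist x y = (if x = y then 0 else (1/2) ^ (LEAST n. x n \<noteq> y n))"

lemma Metric_space_cantor: "Metric_space UNIV cantor_dist"
proof
  fix x y z :: cantor
  show "0 \<le> cantor_dist x y" 
    by (simp add: cantor_dist_def)
  show "cantor_dist x y = cantor_dist y x"
    by (auto simp: cantor_dist_def eq_commute)
  show "cantor_dist x y = 0 \<longleftrightarrow> x = y"
    by (simp add: cantor_dist_def)
  show "cantor_dist x z \<le> cantor_dist x y + cantor_dist y z"
  proof (cases "x = y \<or> y = z \<or> x = z")
    case True
    then show ?thesis by (auto simp: cantor_dist_def)
  next
    case False
    define k where "k = (LEAST n. x n \<noteq> z n)"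
    from False have "\<exists>n. x n \<noteq> z n" by auto
    then have "x k \<noteq> z k" unfolding k_def by (rule LeastI_ex)
    then have "x k \<noteq> y k \<or> y k \<noteq> z k" by auto
    then have "(LEAST n. x n \<noteq> y n) \<le> k \<or> (LEAST n. y n \<noteq> z n) \<le> k"
      by (auto intro: Least_le)
    then have "(1/2::real) ^ k \<le> (1/2) ^ (LEAST n. x n \<noteq> y n) \<or>
        (1/2::real) ^ k \<le> (1/2) ^ (LEAST n. y n \<noteq> z n)"
      by (auto intro: power_decreasing)
    then have "(1/2::real) ^ k \<le> (1/2) ^ (LEAST n. x n \<noteq> y n) + (1/2) ^ (LEAST n. y n \<noteq> z n)"
      by (smt (verit) zero_le_power divide_nonneg_nonneg)
    with False show ?thesis by (simp add: cantor_dist_def k_def)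
  qed
qed

text \<open>The library's \<^const>\<open>diameter\<close> needs a type of class \<^class>\<open>metric_space\<close>; this is the same
  definition for \<^const>\<open>cantor_dist\<close>. All distances are at most 1, so the supremum is
  always a genuine one.\<close>

definition cantor_diam :: "cantor set \<Rightarrow> real" where
  "cantor_diam S = (if S = {} then 0 else SUP (x, y)\<in>S \<times> S. cantor_dist x y)"

definition strong_measure_zero :: "cantor set set" where
  "strong_measure_zero = {X. \<forall>\<epsilon> :: nat \<Rightarrow> real. (\<forall>n. \<epsilon> n > 0) \<longrightarrow>
     (\<exists>C :: nat \<Rightarrow> cantor set. (\<forall>n. cantor_diam (C n) < \<epsilon> n) \<and> X \<subseteq> (\<Union>n. C n))}"

text \<open>With \<^const>\<open>True\<close> as 1 and \<^const>\<open>False\<close> as 0, addition mod 2 is disequality.\<close>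

definition cantor_add :: "cantor \<Rightarrow> cantor \<Rightarrow> cantor" where
  "cantor_add x y = (\<lambda>n. x n \<noteq> y n)"

definition null_additive :: "cantor set set" where
  "null_additive = {X. \<forall>N \<in> lebesgue_null. {cantor_add x y | x y. x \<in> X \<and> y \<in> N} \<in> lebesgue_null}"

end

(*
  SN is contained in NA. Cover a null set N by open sets V k of measure below 2^-(k+1). Given
  f : nat => nat, strong measure zero provides for each k points s f k m such that every x in X
  agrees with some s f k m on its first f (k + m) coordinates. The set
  B f = INT k. UN m. s f k m + V (k + m) is null. If z is in N and f k is so large that the first
  f k coordinates of z already force membership in V k, then x + z lies in B f' for every f' >= f.
  The sets INT f' >= f. B f' are null and increase with f, so GP(all) makes their union null.

  NA is contained in SN, without GP(all). Let W n be the set of z for which the block of n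
  coordinates selected by the first f n coordinates of z vanishes; it has measure 2^-n, and H
  translates of it by points with distinct prefixes of length f n miss only a set of measure
  (1 - 2^-n)^H. As X + limsup W n is null, it misses a closed set K of positive measure. A Baire
  category argument in K splits X into countably many pieces, each attached to a part of K of
  positive measure that is disjoint from x + W n for all x in the piece and all large n. Hence a
  piece has at most 4^n prefixes of length f n for large n. The bound 4^n does not depend on f,
  so f may be chosen to grow fast enough for any prescribed sequence of diameters.
*)
theory Submission
  imports Defs
begin

subsection \<open>The measure on Cantor space\<close>

interpretation coin: product_prob_space "\<lambda>_. measure_pmf (bernoulli_pmf (1/2))" "UNIV :: nat set"
  by unfold_locales

lemma prob_space_cantor: "prob_space cantor_measure"
  unfolding cantor_measure_def by (rule coin.P.prob_space_axioms)

interpretation cantor: prob_space cantor_measure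
  by (rule prob_space_cantor)

lemma space_cantor [simp]: "space cantor_measure = UNIV"
  by (simp add: cantor_measure_def space_PiM)

lemma measurable_cantor_coord [measurable]:
  "(\<lambda>z. z i) \<in> cantor_measure \<rightarrow>\<^sub>M count_space UNIV"
proof -
  have "(\<lambda>z. z i) \<in> cantor_measure \<rightarrow>\<^sub>M measure_pmf (bernoulli_pmf (1/2))"
    unfolding cantor_measure_def by (rule measurable_component_singleton) simp
  then show ?thesis
    by (simp cong: measurable_cong_sets)
qed

lemma measurable_into_cantor:
  assumes "\<And>i. (\<lambda>x. f x i) \<in> M \<rightarrow>\<^sub>M count_space UNIV"
  shows "f \<in> M \<rightarrow>\<^sub>M cantor_measure"
  unfolding cantor_measure_def
  by (rule measurable_PiM_single')
    (use assms in \<open>auto simp: cong: measurable_cong_sets\<close>)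

lemma cantor_sets_CollectI:
  "Measurable.pred cantor_measure P \<Longrightarrow> Collect P \<in> sets cantor_measure"
  by (simp add: pred_def)

definition cylinder :: "cantor \<Rightarrow> nat \<Rightarrow> cantor set" where
  "cylinder z h = {y. \<forall>i<h. y i = z i}"

lemma sets_cylinder [measurable]: "cylinder z h \<in> sets cantor_measure"
  unfolding cylinder_def by (rule cantor_sets_CollectI) measurable

lemma self_in_cylinder: "z \<in> cylinder z h"
  by (simp add: cylinder_def)

lemma cylinder_eq: "y \<in> cylinder z h \<Longrightarrow> cylinder y h = cylinder z h"
  by (auto simp: cylinder_def)

lemma cylinder_antimono: "h \<le> k \<Longrightarrow> cylinder z k \<subseteq> cylinder z h"
  by (auto simp: cylinder_def)

section \<open>Translation invariance of the measure\<close>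

lemma emeasure_bernoulli_half_flip:
  "emeasure (measure_pmf (bernoulli_pmf (1/2))) {b. (b \<noteq> c) \<in> A}
    = emeasure (measure_pmf (bernoulli_pmf (1/2))) A"
proof (cases c)
  case True
  have "bernoulli_pmf (1/2) = map_pmf Not (bernoulli_pmf (1/2))"
  proof (rule pmf_eqI)
    fix b
    have "Not -` {b} = {\<not> b}" by auto
    then show "pmf (bernoulli_pmf (1/2)) b = pmf (map_pmf Not (bernoulli_pmf (1/2))) b"
      by (cases b) (simp_all add: pmf_map measure_pmf_single)
  qed
  then have "emeasure (measure_pmf (bernoulli_pmf (1/2))) A
    = emeasure (measure_pmf (map_pmf Not (bernoulli_pmf (1/2)))) A" by simp
  also have "\<dots> = emeasure (measure_pmf (bernoulli_pmf (1/2))) {b. (b \<noteq> c) \<in> A}"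
    using True by (simp add: vimage_def)
  finally show ?thesis by simp
qed simp

lemma measurable_cantor_add [measurable]:
  "cantor_add x \<in> cantor_measure \<rightarrow>\<^sub>M cantor_measure"
  unfolding cantor_add_def by (rule measurable_into_cantor) measurable

lemma cantor_add_add_cancel [simp]: "cantor_add x (cantor_add x y) = y"
  by (auto simp: cantor_add_def)

text \<open>A product measure is determined by its finite-dimensional boxes. A translation pulls a
  box back to the box whose sides are flipped where \<open>x\<close> is \<open>True\<close>, and the
  fair coin is invariant under flipping.\<close>

lemma distr_cantor_add: "distr cantor_measure cantor_measure (cantor_add x) = cantor_measure"
proof -
  have "distr cantor_measure cantor_measure (cantor_add x)
      = PiM UNIV (\<lambda>_. measure_pmf (bernoulli_pmf (1/2)))"
  proof (rule coin.PiM_eq)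
    show "sets (distr cantor_measure cantor_measure (cantor_add x))
      = sets (PiM UNIV (\<lambda>_. measure_pmf (bernoulli_pmf (1/2))))"
      by (simp add: cantor_measure_def)
  next
    fix J :: "nat set" and F
    assume J: "finite J" "J \<subseteq> UNIV"
    let ?C = "\<lambda>F. prod_emb UNIV (\<lambda>_. measure_pmf (bernoulli_pmf (1/2))) J (Pi\<^sub>E J F)"
    have meas: "?C G \<in> sets cantor_measure" for G
      unfolding cantor_measure_def using J by (intro sets_PiM_I) auto
    have "cantor_add x -` ?C F = ?C (\<lambda>i. {b. (b \<noteq> x i) \<in> F i})"
      by (auto simp: prod_emb_def PiE_iff cantor_add_def space_PiM eq_commute fun_eq_iff)
    then show "emeasure (distr cantor_measure cantor_measure (cantor_add x)) (?C F)
      = (\<Prod>j\<in>J. emeasure (measure_pmf (bernoulli_pmf (1/2))) (F j))"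
      using meas J coin.emeasure_PiM_emb[OF J(2,1), of "\<lambda>i. {b. (b \<noteq> x i) \<in> F i}"]
      by (simp add: emeasure_distr emeasure_bernoulli_half_flip[simplified])
        (simp add: cantor_measure_def emeasure_bernoulli_half_flip[simplified])
  qed
  then show ?thesis by (simp add: cantor_measure_def)
qed

lemma emeasure_translate:
  assumes "A \<in> sets cantor_measure"
  shows "emeasure cantor_measure (cantor_add x -` A) = emeasure cantor_measure A"
  using emeasure_distr[OF measurable_cantor_add assms, of x]
  by (simp add: distr_cantor_add)

lemma sets_translate:
  "A \<in> sets cantor_measure \<Longrightarrow> cantor_add x -` A \<in> sets cantor_measure"
  using measurable_sets[OF measurable_cantor_add] by simp

lemma measure_agree:
  assumes "finite S"
  shows "measure cantor_measure {z. \<forall>i\<in>S. z i = a i} = (1/2) ^ card S"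
proof -
  have "emeasure cantor_measure {z. \<forall>i\<in>S. z i = a i} = ennreal ((1/2) ^ card S)"
  proof -
    have "emeasure (measure_pmf (bernoulli_pmf (1/2))) {b} = ennreal (1/2)" for b
      by (cases b) (simp_all add: emeasure_pmf_single)
    then show ?thesis
      using coin.emeasure_PiM_Collect[of S "\<lambda>i. {a i}"] assms
      by (simp add: cantor_measure_def space_PiM prod_constant flip: ennreal_power)
  qed
  then show ?thesis by (simp add: measure_def)
qed

section \<open>Null sets and open covers\<close>

lemma lebesgue_null_subset: "A \<in> lebesgue_null \<Longrightarrow> B \<subseteq> A \<Longrightarrow> B \<in> lebesgue_null"
  unfolding lebesgue_null_def by (rule null_sets_completion_subset)

lemma lebesgue_nullI: "A \<in> null_sets cantor_measure \<Longrightarrow> A \<in> lebesgue_null"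
  unfolding lebesgue_null_def by (rule null_sets_completionI)

lemma lebesgue_nullE:
  assumes "A \<in> lebesgue_null"
  obtains B where "A \<subseteq> B" "B \<in> null_sets cantor_measure"
  using assms unfolding lebesgue_null_def null_sets_completion_iff2 by auto

text \<open>Openness in the metric \<open>cantor_dist\<close>: cylinders of length \<open>h\<close>
  are its closed balls of radius \<open>(1/2) ^ h\<close>.\<close>

definition cantor_open :: "cantor set \<Rightarrow> bool" where
  "cantor_open U \<longleftrightarrow> (\<forall>z\<in>U. \<exists>h. cylinder z h \<subseteq> U)"

text \<open>Sequential continuity is enough: if no cylinder around \<open>z\<close> stays in the
  preimage, points of ever longer cylinders that leave it converge to \<open>z\<close>.\<close>

lemma cantor_open_vimage:
  fixes g :: "cantor \<Rightarrow> 'a :: topological_space"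
  assumes "open U" and g: "\<And>z y. (\<And>n. y n \<in> cylinder z n) \<Longrightarrow> (\<lambda>n. g (y n)) \<longlonglongrightarrow> g z"
  shows "cantor_open (g -` U)"
  unfolding cantor_open_def
proof (rule ballI, rule ccontr)
  fix z assume z: "z \<in> g -` U" and "\<not> (\<exists>h. cylinder z h \<subseteq> g -` U)"
  then have "\<forall>n. \<exists>y. y \<in> cylinder z n \<and> g y \<notin> U" by blast
  then obtain y where y: "\<And>n. y n \<in> cylinder z n" "\<And>n. g (y n) \<notin> U" by metis
  have "eventually (\<lambda>n. g (y n) \<in> U) sequentially"
    using g[OF y(1)] assms(1) z by (auto dest: topological_tendstoD)
  with y(2) show False by simp
qed

text \<open>The library's outer regularity needs a complete metric space, so the measure is pushed forward
  to \<^typ>\<open>nat \<Rightarrow> real\<close>.\<close>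

lemma null_open_cover:
  assumes N: "N \<in> lebesgue_null" and e: "e > 0"
  obtains U where "U \<in> sets cantor_measure" "N \<subseteq> U" "cantor_open U"
    "emeasure cantor_measure U < e"
proof -
  obtain B where B: "N \<subseteq> B" "B \<in> null_sets cantor_measure"
    using lebesgue_nullE[OF N] .
  define g :: "cantor \<Rightarrow> nat \<Rightarrow> real" where "g z n = of_bool (z n)" for z n
  \<comment> \<open>\<open>r\<close> is a measurable left inverse of the embedding \<open>g\<close>.
    Taking the preimage of \<open>B\<close> under \<open>r\<close> yields a Borel set at once,
    without any study of the image of \<open>B\<close> under \<open>g\<close>.\<close>
  define r :: "(nat \<Rightarrow> real) \<Rightarrow> cantor" where "r w n \<longleftrightarrow> w n > 1/2" for w n
  have rg: "r (g z) = z" for z by (rule ext) (simp add: r_def g_def)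
  have g_meas: "g \<in> cantor_measure \<rightarrow>\<^sub>M borel"
    by (rule measurable_coordinatewise_then_product) (simp add: g_def)
  have r_meas: "r \<in> borel \<rightarrow>\<^sub>M cantor_measure"
    by (rule measurable_into_cantor) (simp add: r_def)
  define P where "P = distr cantor_measure borel g"
  interpret P: prob_space P
    unfolding P_def by (rule cantor.prob_space_distr[OF g_meas])
  have rB: "r -` B \<in> sets borel"
    using measurable_sets[OF r_meas, of B] B(2) by auto
  have "emeasure P (r -` B) = 0"
    using B(2) rB by (simp add: P_def emeasure_distr[OF g_meas] vimage_def rg null_setsD1)
  moreover have "emeasure P (r -` B) = (INF U \<in> {U. r -` B \<subseteq> U \<and> open U}. emeasure P U)"
    by (rule outer_regular) (use rB P.emeasure_space_1 in \<open>auto simp: P_def\<close>)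
  ultimately have "(INF U \<in> {U. r -` B \<subseteq> U \<and> open U}. emeasure P U) < e"
    using e by simp
  then obtain U where U: "r -` B \<subseteq> U" "open U" "emeasure P U < e"
    by (auto simp: INF_less_iff)
  have "cantor_open (g -` U)"
  proof (rule cantor_open_vimage[OF U(2)])
    fix z y assume y: "\<And>n. y n \<in> cylinder z n"
    have "(\<lambda>n. g (y n) i) \<longlonglongrightarrow> g z i" for i
    proof (rule tendsto_eventually)
      show "\<forall>\<^sub>F n in sequentially. g (y n) i = g z i"
        using eventually_gt_at_top[of i]
        by eventually_elim (use y in \<open>auto simp: cylinder_def g_def\<close>)
    qed
    then show "(\<lambda>n. g (y n)) \<longlonglongrightarrow> g z"
      using limitin_componentwise[of "\<lambda>_. euclidean" UNIV "\<lambda>n. g (y n)" "g z" sequentially]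
      by (simp add: euclidean_product_topology)
  qed
  moreover have "g -` U \<in> sets cantor_measure"
    using measurable_sets[OF g_meas, of U] U(2) by auto
  moreover have "N \<subseteq> g -` U"
  proof
    fix z assume "z \<in> N"
    then have "g z \<in> r -` B" using B(1) rg by auto
    with U(1) show "z \<in> g -` U" by auto
  qed
  moreover have "emeasure cantor_measure (g -` U) < e"
    using U(2,3) by (simp add: P_def emeasure_distr[OF g_meas])
  ultimately show thesis using that by blast
qed

subsection \<open>Strong measure zero sets are null-additive\<close>

lemma cantor_dist_le_diam:
  assumes "x \<in> S" "y \<in> S"
  shows "cantor_dist x y \<le> cantor_diam S"
proof -
  have "cantor_dist a b \<le> 1" for a b
    by (simp add: cantor_dist_def power_le_one)
  then have "bdd_above ((\<lambda>(x, y). cantor_dist x y) ` (S \<times> S))"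
    by (intro bdd_aboveI[of _ 1]) auto
  from cSUP_upper[OF _ this, of "(x, y)"] show ?thesis
    using assms by (auto simp: cantor_diam_def)
qed

lemma cylinderI_dist:
  assumes "cantor_dist x y < (1/2) ^ h"
  shows "x \<in> cylinder y h"
proof (rule ccontr)
  assume "x \<notin> cylinder y h"
  then obtain i where i: "i < h" "x i \<noteq> y i" by (auto simp: cylinder_def)
  then have "(LEAST n. x n \<noteq> y n) \<le> h"
    using Least_le[of "\<lambda>n. x n \<noteq> y n" i] by simp
  then have "(1/2::real) ^ h \<le> (1/2) ^ (LEAST n. x n \<noteq> y n)"
    by (simp add: power_decreasing)
  moreover have "x \<noteq> y" using i by auto
  ultimately show False using assms by (simp add: cantor_dist_def)
qed

lemma strong_measure_zero_cylinders:
  fixes h :: "nat \<Rightarrow> nat"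
  assumes "X \<in> strong_measure_zero"
  shows "\<exists>s. X \<subseteq> (\<Union>m. cylinder (s m) (h m))"
proof -
  have "\<exists>C. (\<forall>m. cantor_diam (C m) < (1/2) ^ h m) \<and> X \<subseteq> (\<Union>m. C m)"
    using assms[unfolded strong_measure_zero_def, THEN CollectD, THEN spec, of "\<lambda>m. (1/2) ^ h m"]
    by simp
  then obtain C where C: "\<And>m. cantor_diam (C m) < (1/2) ^ h m" "X \<subseteq> (\<Union>m. C m)"
    by blast
  \<comment> \<open>If \<open>C m\<close> is empty the chosen centre is arbitrary, which does no
    harm since nothing has to be covered.\<close>
  have "C m \<subseteq> cylinder (SOME c. c \<in> C m) (h m)" for m
  proof
    fix x assume x: "x \<in> C m"
    then have "(SOME c. c \<in> C m) \<in> C m" by (rule someI[where P = "\<lambda>c. c \<in> C m"])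
    with x C(1)[of m] show "x \<in> cylinder (SOME c. c \<in> C m) (h m)"
      by (intro cylinderI_dist) (meson cantor_dist_le_diam le_less_trans)
  qed
  with C(2) show ?thesis by (intro exI[of _ "\<lambda>m. SOME c. c \<in> C m"]) blast
qed

text \<open>Translations preserve measure, so for arbitrary \<open>s\<close> the \<open>k\<close>-th
  union has measure at most the tail \<open>(1/2) ^ k\<close> of the geometric series.\<close>

lemma limsup_translates_null:
  assumes V: "\<And>k. V k \<in> sets cantor_measure"
    and le: "\<And>k. emeasure cantor_measure (V k) \<le> ennreal ((1/2) ^ Suc k)"
  shows "(\<Inter>k. \<Union>m. cantor_add (s k m) -` V (k + m)) \<in> null_sets cantor_measure"
    (is "(\<Inter>k. ?U k) \<in> _")
proof (rule null_setsI)
  have U: "?U k \<in> sets cantor_measure" for k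
    using V by (intro sets.countable_UN) (auto intro: sets_translate)
  then show "(\<Inter>k. ?U k) \<in> sets cantor_measure" 
    by (intro sets.countable_INT) auto
  have "emeasure cantor_measure (?U k) \<le> ennreal ((1/2) ^ k)" for k
  proof -
    have "emeasure cantor_measure (?U k)
        \<le> (\<Sum>m. emeasure cantor_measure (cantor_add (s k m) -` V (k + m)))"
      using V by (intro emeasure_subadditive_countably) (auto intro: sets_translate)
    also have "\<dots> \<le> (\<Sum>m. ennreal ((1/2) ^ Suc (k + m)))"
      using V le by (intro suminf_le) (auto simp: emeasure_translate)
    also have "\<dots> = ennreal ((1/2) ^ k)"
    proof (rule suminf_ennreal_eq)
      show "(\<lambda>m. (1/2::real) ^ Suc (k + m)) sums (1/2) ^ k"
        using sums_mult[OF power_half_series, of "(1/2) ^ k"] by (simp add: power_add mult_ac)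
    qed simp
    finally show ?thesis .
  qed
  moreover have "emeasure cantor_measure (\<Inter>k. ?U k) \<le> emeasure cantor_measure (?U k)" for k
    using U by (intro emeasure_mono) auto
  ultimately have *: "emeasure cantor_measure (\<Inter>k. ?U k) \<le> ennreal ((1/2) ^ k)" for k
    by (rule order_trans[rotated])
  have "(\<lambda>k. ennreal ((1/2) ^ k)) \<longlonglongrightarrow> ennreal 0"
    by (intro tendsto_ennrealI LIMSEQ_power_zero) auto
  then have "emeasure cantor_measure (\<Inter>k. ?U k) \<le> ennreal 0"
    by (rule LIMSEQ_le_const) (use * in blast)
  then show "emeasure cantor_measure (\<Inter>k. ?U k) = 0" by simp
qed

text \<open>Turns a family without any monotonicity into one to which \<open>GP_all\<close> applies:
  as \<open>f\<close> grows, fewer sets are intersected, and each intersection lies in the null set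
  \<open>B f\<close>.\<close>

lemma GP_all_eventually_in_null:
  fixes B :: "(nat \<Rightarrow> nat) \<Rightarrow> cantor set"
  assumes "GP_all" and B: "\<And>f. B f \<in> lebesgue_null"
  shows "(\<Union>f. \<Inter>f'\<in>{f..}. B f') \<in> lebesgue_null"
proof -
  have "(\<Inter>f'\<in>{f..}. B f') \<in> lebesgue_null" for f
    using B[of f] by (rule lebesgue_null_subset) auto
  moreover have "(\<Inter>f'\<in>{f..}. B f') \<subseteq> (\<Inter>f'\<in>{g..}. B f')" if "f \<le> g" for f g
    using that by (auto intro: order_trans)
  ultimately show ?thesis
    using assms(1)[unfolded GP_all_def, THEN spec, of "\<lambda>f. \<Inter>f'\<in>{f..}. B f'"] by simp
qed

lemma GP_all_strong_measure_zero_null_additive: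
  assumes "GP_all" and X: "X \<in> strong_measure_zero"
  shows "X \<in> null_additive"
  unfolding null_additive_def
proof (intro CollectI ballI)
  fix N assume N: "N \<in> lebesgue_null"
  have "\<exists>U. U \<in> sets cantor_measure \<and> N \<subseteq> U \<and> cantor_open U \<and>
      emeasure cantor_measure U < ennreal ((1/2) ^ Suc k)" for k
    by (rule null_open_cover[OF N, of "ennreal ((1/2) ^ Suc k)"]) (simp, blast)
  then obtain V where V: "\<And>k. V k \<in> sets cantor_measure" "\<And>k. N \<subseteq> V k"
    "\<And>k. cantor_open (V k)" "\<And>k. emeasure cantor_measure (V k) < ennreal ((1/2) ^ Suc k)"
    by metis
  \<comment> \<open>A separate cover for each tail of \<open>f\<close> places every point of
    \<open>X\<close> in a cylinder of index at least \<open>k\<close>, for every \<open>k\<close>.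
    The choices for different \<open>f\<close> are unrelated, so \<open>B\<close> below need not be
    monotone.\<close>
  define s where "s f k = (SOME s. X \<subseteq> (\<Union>m. cylinder (s m) (f (k + m))))"
    for f :: "nat \<Rightarrow> nat" and k
  have s: "X \<subseteq> (\<Union>m. cylinder (s f k m) (f (k + m)))" for f k
    using someI_ex[OF strong_measure_zero_cylinders[OF X, of "\<lambda>m. f (k + m)"]] unfolding s_def .
  define B where "B f = (\<Inter>k. \<Union>m. cantor_add (s f k m) -` V (k + m))" for f
  have B_null: "B f \<in> lebesgue_null" for f
    unfolding B_def
    by (rule lebesgue_nullI, rule limsup_translates_null, rule V(1), rule less_imp_le, rule V(4))
  have "{cantor_add x z | x z. x \<in> X \<and> z \<in> N} \<subseteq> (\<Union>f. \<Inter>f'\<in>{f..}. B f')"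
  proof clarify
    fix x z assume x: "x \<in> X" and z: "z \<in> N"
    have "\<forall>k. \<exists>h. cylinder z h \<subseteq> V k"
      using V(2,3) z unfolding cantor_open_def by blast
    \<comment> \<open>This \<open>f\<close> depends on \<open>z\<close> alone and records how long a
      prefix of \<open>z\<close> forces membership in each \<open>V k\<close>.\<close>
    then obtain f where f: "\<And>k. cylinder z (f k) \<subseteq> V k" by metis
    have "cantor_add x z \<in> B f'" if f': "f \<le> f'" for f'
      unfolding B_def
    proof
      fix k
      obtain m where m: "x \<in> cylinder (s f' k m) (f' (k + m))"
        using s[where ?f = f' and ?k = k] x by blast
      \<comment> \<open>The sum of \<open>s f' k m\<close> and \<open>x\<close> vanishes on the
        common prefix, so adding it leaves that prefix of \<open>z\<close> unchanged.\<close>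
      then have "cantor_add (s f' k m) (cantor_add x z) \<in> cylinder z (f' (k + m))"
        by (auto simp: cylinder_def cantor_add_def)
      also have "\<dots> \<subseteq> cylinder z (f (k + m))"
        using f' by (intro cylinder_antimono) (simp add: le_fun_def)
      also have "\<dots> \<subseteq> V (k + m)" by (rule f)
      finally show "cantor_add x z \<in> (\<Union>m. cantor_add (s f' k m) -` V (k + m))" by blast
    qed
    then show "cantor_add x z \<in> (\<Union>f. \<Inter>f'\<in>{f..}. B f')" by blast
  qed
  then show "{cantor_add x z | x z. x \<in> X \<and> z \<in> N} \<in> lebesgue_null"
    by (rule lebesgue_null_subset[OF GP_all_eventually_in_null[OF assms(1) B_null]])
qed

subsection \<open>Null-additive sets have strong measure zero\<close>

text \<open>The prefix is coded as a number because it will serve as the index of a block of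
  coordinates.\<close>

definition prefix_code :: "nat \<Rightarrow> cantor \<Rightarrow> nat" where
  "prefix_code h z = to_nat (map z [0..<h])"

lemma prefix_code_eq_iff: "prefix_code h y = prefix_code h z \<longleftrightarrow> y \<in> cylinder z h"
  by (auto simp: prefix_code_def cylinder_def)

lemma cylinder_eq_list: "cylinder z h = {y. map y [0..<length l] = l}" if "l = map z [0..<h]"
  using that by (auto simp: cylinder_def)

lemma countable_cylinders: "countable {cylinder z h | z h. P z h}"
proof (rule countable_subset)
  show "{cylinder z h | z h. P z h} \<subseteq> range (\<lambda>l :: bool list. {y. map y [0..<length l] = l})"
    using cylinder_eq_list by blast
qed simp

lemma cantor_open_sets:
  assumes "cantor_open U"
  shows "U \<in> sets cantor_measure"
proof -
  have "U = \<Union>{cylinder z h | z h. cylinder z h \<subseteq> U}"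
    using assms self_in_cylinder unfolding cantor_open_def by fast
  also have "\<dots> \<in> sets cantor_measure"
    by (rule sets.countable_Union[OF countable_cylinders]) auto
  finally show ?thesis .
qed

section \<open>Baire category in a closed set\<close>

lemma cantor_open_UN:
  assumes "\<And>i. i \<in> I \<Longrightarrow> cantor_open (U i)"
  shows "cantor_open (\<Union>i\<in>I. U i)"
  unfolding cantor_open_def
proof
  fix z assume "z \<in> (\<Union>i\<in>I. U i)"
  then obtain i where "i \<in> I" "z \<in> U i" by blast
  moreover from this obtain h where "cylinder z h \<subseteq> U i"
    using assms unfolding cantor_open_def by blast
  ultimately show "\<exists>h. cylinder z h \<subseteq> (\<Union>i\<in>I. U i)" by blast
qed

text \<open>Nested cylinders centred at points of \<open>K\<close> enter one \<open>U n\<close>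
  after the other. Their common point is a limit of the centres, hence in \<open>K\<close>.\<close>

lemma cantor_baire:
  fixes U :: "nat \<Rightarrow> cantor set"
  assumes closed: "cantor_open (- K)" and "K \<noteq> {}"
    and opn: "\<And>n. cantor_open (U n)"
    and dense: "\<And>y h n. y \<in> K \<Longrightarrow> K \<inter> cylinder y h \<inter> U n \<noteq> {}"
  shows "K \<inter> (\<Inter>n. U n) \<noteq> {}"
proof -
  have "\<exists>s. \<forall>n. fst (s n) \<in> K \<and>
      (fst (s (Suc n)) \<in> cylinder (fst (s n)) (snd (s n)) \<and> snd (s n) < snd (s (Suc n)) \<and>
       cylinder (fst (s (Suc n))) (snd (s (Suc n))) \<subseteq> U n)"
  proof (rule dependent_nat_choice)
    obtain y where "y \<in> K" using assms(2) by blast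
    then show "\<exists>p :: cantor \<times> nat. fst p \<in> K" by (intro exI[of _ "(y, 0)"]) simp
  next
    fix p :: "cantor \<times> nat" and n
    assume "fst p \<in> K"
    then obtain y where y: "y \<in> K" "y \<in> cylinder (fst p) (snd p)" "y \<in> U n"
      using dense by blast
    then obtain h where "cylinder y h \<subseteq> U n" 
      using opn unfolding cantor_open_def by blast
    \<comment> \<open>The maximum makes the lengths strictly increase, so that the nested cylinders
      shrink to one point.\<close>
    then have "cylinder y (max h (Suc (snd p))) \<subseteq> U n"
      using cylinder_antimono[of h "max h (Suc (snd p))" y] by simp
    with y show "\<exists>q. fst q \<in> K \<and> fst q \<in> cylinder (fst p) (snd p) \<and> snd p < snd q \<and>
        cylinder (fst q) (snd q) \<subseteq> U n"
      by (intro exI[of _ "(y, max h (Suc (snd p)))"]) simp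
  qed
  then obtain s where s: "\<forall>n. fst (s n) \<in> K \<and>
      (fst (s (Suc n)) \<in> cylinder (fst (s n)) (snd (s n)) \<and> snd (s n) < snd (s (Suc n)) \<and>
       cylinder (fst (s (Suc n))) (snd (s (Suc n))) \<subseteq> U n)" by blast
  define y h where "y n = fst (s n)" and "h n = snd (s n)" for n
  have yK: "y n \<in> K" and step: "y (Suc n) \<in> cylinder (y n) (h n)" "h n < h (Suc n)"
    and sub: "cylinder (y (Suc n)) (h (Suc n)) \<subseteq> U n" for n
    using s by (auto simp: y_def h_def)
  have h_ge: "n \<le> h n" for n
    by (rule strict_mono_imp_increasing) (simp add: strict_mono_Suc_iff step(2))
  have nested: "y m \<in> cylinder (y k) (h k) \<and> h k \<le> h m" if "k \<le> m" for k m
    using that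
  proof (induction m rule: dec_induct)
    case base
    show ?case by (simp add: self_in_cylinder)
  next
    case (step m)
    with \<open>\<And>n. y (Suc n) \<in> cylinder (y n) (h n)\<close>[of m] \<open>\<And>n. h n < h (Suc n)\<close>[of m]
    show ?case by (auto simp: cylinder_def)
  qed
  \<comment> \<open>Since \<open>h (Suc i)\<close> exceeds \<open>i\<close>, coordinate
    \<open>i\<close> no longer changes from stage \<open>Suc i\<close> on.\<close>
  define w where "w i = y (Suc i) i" for i
  have w: "w \<in> cylinder (y k) (h k)" for k
    unfolding cylinder_def
  proof clarify
    fix i assume i: "i < h k"
    show "w i = y k i"
    proof (cases "k \<le> Suc i")
      case True
      with nested[OF this] i show ?thesis by (simp add: cylinder_def w_def)
    next
      case False
      with nested[of "Suc i" k] h_ge[of "Suc i"] show ?thesis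
        by (simp add: cylinder_def w_def)
    qed
  qed
  have "w \<in> K"
  proof (rule ccontr)
    assume "w \<notin> K"
    then obtain q where "cylinder w q \<subseteq> - K"
      using closed unfolding cantor_open_def by blast
    moreover have "y q \<in> cylinder w q"
      using w[of q] h_ge[of q] by (auto simp: cylinder_def)
    ultimately show False using yK by blast
  qed
  moreover have "w \<in> U n" for n using w[of "Suc n"] sub by blast
  ultimately show ?thesis by blast
qed

section \<open>Independence of block events\<close>

text \<open>Induction on \<open>J\<close>. Avoiding one more block means subtracting the event that
  it is matched, which has the same form with \<open>S\<close> enlarged by that block; hence
  \<open>S\<close> is kept general.\<close>

lemma measure_avoid_blocks:
  fixes B :: "nat \<Rightarrow> nat set"
  assumes "finite J" "finite S" "\<And>j. j \<in> J \<Longrightarrow> finite (B j) \<and> card (B j) = n \<and> S \<inter> B j = {}"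
    and "disjoint_family_on B J"
  shows "measure cantor_measure {z. (\<forall>i\<in>S. z i = a i) \<and> (\<forall>j\<in>J. \<exists>i\<in>B j. z i \<noteq> a i)}
    = (1/2) ^ card S * (1 - (1/2) ^ n) ^ card J"
  using assms
proof (induction J arbitrary: S rule: finite_induct)
  case empty
  then show ?case by (simp add: measure_agree)
next
  case (insert j J)
  let ?E = "\<lambda>S. {z. (\<forall>i\<in>S. z i = a i) \<and> (\<forall>j\<in>J. \<exists>i\<in>B j. z i \<noteq> a i)}"
  have meas: "?E T \<in> sets cantor_measure" for T
    unfolding Ball_def Bex_def by (rule cantor_sets_CollectI) measurable
  have disj: "disjoint_family_on B J" "\<And>k. k \<in> J \<Longrightarrow> B j \<inter> B k = {}"
    using insert.prems(3) insert.hyps(2) by (auto simp: disjoint_family_on_def)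
  have E1: "measure cantor_measure (?E S) = (1/2) ^ card S * (1 - (1/2) ^ n) ^ card J"
    using insert.prems(1,2) disj(1) by (intro insert.IH) simp_all
  have E2: "measure cantor_measure (?E (S \<union> B j))
      = (1/2) ^ card (S \<union> B j) * (1 - (1/2) ^ n) ^ card J"
    using insert.prems(1,2) disj by (intro insert.IH) (simp_all add: Int_Un_distrib2)
  have c: "card (S \<union> B j) = card S + n"
    using insert.prems(1,2) by (subst card_Un_disjoint) auto
  have d: "measure cantor_measure (?E S - ?E (S \<union> B j))
      = measure cantor_measure (?E S) - measure cantor_measure (?E (S \<union> B j))"
    by (rule cantor.finite_measure_Diff) (use meas in auto)
  have eq: "{z. (\<forall>i\<in>S. z i = a i) \<and> (\<forall>k\<in>insert j J. \<exists>i\<in>B k. z i \<noteq> a i)}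
      = ?E S - ?E (S \<union> B j)"
    by auto
  show ?case
    unfolding eq d E1 E2 c using insert.hyps by (simp add: power_add algebra_simps)
qed

text \<open>Starting at \<open>h\<close> keeps every block off the coordinates whose prefix selects
  it.\<close>

definition block :: "nat \<Rightarrow> nat \<Rightarrow> nat \<Rightarrow> nat set" where
  "block h n c = {h + c * n..<h + c * n + n}"

lemma finite_block [simp]: "finite (block h n c)"
  and card_block [simp]: "card (block h n c) = n"
  by (simp_all add: block_def)

lemma block_ge: "i \<in> block h n c \<Longrightarrow> h \<le> i"
  by (simp add: block_def)

lemma block_disjoint:
  assumes "i \<in> block h n c" "i \<in> block h n d"
  shows "c = d"
proof -
  have "(i - h) div n = e" if "i \<in> block h n e" for e
    by (rule div_nat_eqI) (use that in \<open>auto simp: block_def algebra_simps\<close>)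
  with assms show ?thesis by blast
qed

text \<open>The first \<open>h\<close> coordinates select which block has to vanish. Translating by points with
  distinct prefixes therefore selects disjoint blocks over every prefix, which makes the translates
  independent.\<close>

definition zero_block_set :: "nat \<Rightarrow> nat \<Rightarrow> cantor set" where
  "zero_block_set h n = {z. \<forall>i\<in>block h n (prefix_code h z). \<not> z i}"

text \<open>Membership is decided by the first \<open>h\<close> coordinates and the block they
  select, so by a finite prefix.\<close>

lemma cantor_open_zero_block: "cantor_open (cantor_add x -` zero_block_set h n)"
  unfolding cantor_open_def
proof
  fix z assume z: "z \<in> cantor_add x -` zero_block_set h n"
  let ?c = "prefix_code h (cantor_add x z)"
  have "cylinder z (h + ?c * n + n) \<subseteq> cantor_add x -` zero_block_set h n"
  proof
    fix y assume y: "y \<in> cylinder z (h + ?c * n + n)"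
    then have code: "prefix_code h (cantor_add x y) = ?c"
      by (auto simp: prefix_code_eq_iff cylinder_def cantor_add_def)
    have "\<not> cantor_add x y i" if i: "i \<in> block h n ?c" for i
    proof -
      have "y i = z i" using y i by (simp add: cylinder_def block_def)
      moreover have "\<not> cantor_add x z i" using z i by (simp add: zero_block_set_def)
      ultimately show ?thesis by (simp add: cantor_add_def)
    qed
    then show "y \<in> cantor_add x -` zero_block_set h n"
      by (simp add: zero_block_set_def code)
  qed
  then show "\<exists>k. cylinder z k \<subseteq> cantor_add x -` zero_block_set h n" by blast
qed

lemma cantor_open_zero_block_set: "cantor_open (zero_block_set h n)"
proof -
  have "cantor_add (\<lambda>_. False) -` zero_block_set h n = zero_block_set h n"
    by (auto simp: cantor_add_def)
  then show ?thesis using cantor_open_zero_block[of "\<lambda>_. False" h n] by simp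
qed

text \<open>On a cylinder of length \<open>h\<close> the block selected by each translate is fixed,
  and different \<open>x\<close> select different blocks. A hit by \<open>x\<close> means agreement
  with \<open>x\<close> on its block, so \<open>measure_avoid_blocks\<close> applies.\<close>

lemma measure_avoid_translates_in_cylinder:
  assumes T: "finite T" "inj_on (prefix_code h) T"
  shows "measure cantor_measure
      {y \<in> cylinder p h. \<forall>x\<in>T. cantor_add x y \<notin> zero_block_set h n}
    = (1/2) ^ h * (1 - (1/2) ^ n) ^ card T"
proof -
  define c where "c x = prefix_code h (cantor_add x p)" for x
  have c_inj: "inj_on c T"
  proof (rule inj_onI)
    fix x x' assume x: "x \<in> T" "x' \<in> T" "c x = c x'"
    then have "prefix_code h x = prefix_code h x'"
      by (auto simp: c_def prefix_code_eq_iff cylinder_def cantor_add_def)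
    with T(2) x show "x = x'" by (auto dest: inj_onD)
  qed
  \<comment> \<open>One point combining \<open>p\<close> below \<open>h\<close> with each
    \<open>x\<close> on its own block. The choice is unique on these blocks and irrelevant
    elsewhere.\<close>
  define a where "a i = (if i < h then p i else (SOME x. x \<in> T \<and> i \<in> block h n (c x)) i)" for i
  have a: "a i = x i" if "x \<in> T" "i \<in> block h n (c x)" for x i
  proof -
    have "(SOME x. x \<in> T \<and> i \<in> block h n (c x)) = x"
      using that c_inj by (intro some_equality) (auto dest: block_disjoint inj_onD)
    moreover have "\<not> i < h" using block_ge[OF that(2)] by simp
    ultimately show ?thesis by (simp add: a_def)
  qed
  have hit: "cantor_add x y \<in> zero_block_set h n \<longleftrightarrow> (\<forall>i\<in>block h n (c x). y i = a i)"
    if "y \<in> cylinder p h" "x \<in> T" for x y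
  proof -
    have "prefix_code h (cantor_add x y) = c x"
      using that(1) by (auto simp: c_def prefix_code_eq_iff cylinder_def cantor_add_def)
    then show ?thesis using a[OF that(2)] by (auto simp: zero_block_set_def cantor_add_def)
  qed
  have cyl: "y \<in> cylinder p h \<longleftrightarrow> (\<forall>i\<in>{..<h}. y i = a i)" for y
    by (auto simp: cylinder_def a_def)
  have "{y \<in> cylinder p h. \<forall>x\<in>T. cantor_add x y \<notin> zero_block_set h n}
      = {y. (\<forall>i\<in>{..<h}. y i = a i) \<and> (\<forall>j\<in>c ` T. \<exists>i\<in>block h n j. y i \<noteq> a i)}"
    unfolding cyl[symmetric] using hit by blast
  also have "measure cantor_measure \<dots> = (1/2) ^ card {..<h} * (1 - (1/2) ^ n) ^ card (c ` T)"
    using T(1) by (intro measure_avoid_blocks)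
      (auto simp: disjoint_family_on_def dest: block_ge block_disjoint)
  finally show ?thesis using c_inj by (simp add: card_image)
qed

text \<open>Sum over the \<open>2 ^ h\<close> cylinders of length \<open>h\<close>, all of which
  contribute equally.\<close>

lemma measure_avoid_translates:
  assumes T: "finite T" "inj_on (prefix_code h) T"
  shows "measure cantor_measure {y. \<forall>x\<in>T. cantor_add x y \<notin> zero_block_set h n}
    = (1 - (1/2) ^ n) ^ card T"
proof -
  let ?L = "{l :: bool list. set l \<subseteq> UNIV \<and> length l = h}"
  let ?E = "\<lambda>p. {y \<in> cylinder p h. \<forall>x\<in>T. cantor_add x y \<notin> zero_block_set h n}"
  have L: "finite ?L" "card ?L = 2 ^ h"
    using finite_lists_length_eq[of "UNIV :: bool set" h] card_lists_length_eq[of "UNIV :: bool set" h]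
    by simp_all
  have "cantor_add x -` zero_block_set h n \<in> sets cantor_measure" for x
    by (rule cantor_open_sets[OF cantor_open_zero_block])
  then have "Measurable.pred cantor_measure (\<lambda>y. cantor_add x y \<in> zero_block_set h n)" for x
    by (simp add: pred_def vimage_def)
  note [measurable] = this
  have meas: "?E p \<in> sets cantor_measure" for p
    using T(1) by (intro cantor_sets_CollectI) measurable
  have "{y. \<forall>x\<in>T. cantor_add x y \<notin> zero_block_set h n} = (\<Union>l\<in>?L. ?E (nth l))"
  proof -
    have "\<exists>l\<in>?L. y \<in> cylinder (nth l) h" for y
      by (rule bexI[of _ "map y [0..<h]"]) (auto simp: cylinder_def)
    then show ?thesis by blast
  qed
  also have "measure cantor_measure \<dots> = (\<Sum>l\<in>?L. measure cantor_measure (?E (nth l)))"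
  proof (rule cantor.finite_measure_finite_Union)
    have "l = l'" if "y \<in> cylinder (nth l) h" "y \<in> cylinder (nth l') h" "length l = h" "length l' = h"
      for l l' :: "bool list" and y
      using that by (intro nth_equalityI) (auto simp: cylinder_def)
    then show "disjoint_family_on (\<lambda>l. ?E (nth l)) ?L"
      unfolding disjoint_family_on_def by blast
  qed (use L meas in auto)
  also have "\<dots> = (1 - (1/2) ^ n) ^ card T"
    unfolding measure_avoid_translates_in_cylinder[OF T] using L
    by (simp add: power_divide)
  finally show ?thesis .
qed

lemma measure_zero_block_set: "measure cantor_measure (zero_block_set h n) = (1/2) ^ n"
proof -
  have "measure cantor_measure (- zero_block_set h n) = 1 - (1/2) ^ n"
    using measure_avoid_translates[of "{\<lambda>_. False}" h n]
    by (simp add: cantor_add_def Compl_eq)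
  then show ?thesis
    using cantor.prob_compl[OF cantor_open_sets[OF cantor_open_zero_block_set], of h n]
    by (simp add: Compl_eq_Diff_UNIV)
qed

text \<open>Borel-Cantelli: the measures \<open>(1/2) ^ n\<close> are summable and independent of
  \<open>f\<close>, so \<open>f\<close> may grow as fast as desired.\<close>

lemma limsup_zero_block_null:
  "(\<Inter>m. \<Union>n\<in>{m..}. zero_block_set (f n) n) \<in> null_sets cantor_measure"
proof -
  have "limsup (\<lambda>n. zero_block_set (f n) n) \<in> null_sets cantor_measure"
  proof (rule borel_cantelli_limsup1)
    show "summable (\<lambda>n. measure cantor_measure (zero_block_set (f n) n))"
      by (simp add: measure_zero_block_set summable_geometric)
  qed (auto simp: cantor_open_sets[OF cantor_open_zero_block_set] cantor.emeasure_finite less_top[symmetric])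
  then show ?thesis by (simp add: limsup_INF_SUP)
qed

section \<open>Counting prefixes and building covers\<close>

text \<open>\<open>H\<close> points of \<open>Y\<close> with distinct prefixes would confine
  \<open>K\<close> to an event of measure \<open>(1 - (1/2) ^ n) ^ H\<close>, which is too
  small.\<close>

lemma few_prefixes:
  assumes K: "K \<in> sets cantor_measure" "(1 - (1/2) ^ n) ^ H < measure cantor_measure K"
    and avoid: "\<And>x y. x \<in> Y \<Longrightarrow> y \<in> K \<Longrightarrow> cantor_add x y \<notin> zero_block_set h n"
  shows "finite (prefix_code h ` Y) \<and> card (prefix_code h ` Y) \<le> H"
proof (rule ccontr)
  assume "\<not> ?thesis"
  \<comment> \<open>Whether the set of prefixes is infinite or merely too large, it contains exactly
    \<open>H\<close> prefixes to work with.\<close>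
  then obtain P where "P \<subseteq> prefix_code h ` Y" "finite P" "card P = H"
    by (metis infinite_arbitrarily_large nat_le_linear obtain_subset_with_card_n)
  then obtain T where T: "T \<subseteq> Y" "inj_on (prefix_code h) T" "P = prefix_code h ` T"
    by (metis subset_image_inj)
  have "finite T" "card T = H"
    using T \<open>finite P\<close> \<open>card P = H\<close> by (auto simp: finite_image_iff card_image)
  let ?E = "{y. \<forall>x\<in>T. cantor_add x y \<notin> zero_block_set h n}"
  have "?E = UNIV - (\<Union>x\<in>T. cantor_add x -` zero_block_set h n)" by auto
  also have "\<dots> \<in> sets cantor_measure"
    using \<open>finite T\<close> sets.top[of cantor_measure]
    by (intro sets.Diff sets.finite_UN cantor_open_sets[OF cantor_open_zero_block]) auto
  finally have "measure cantor_measure K \<le> measure cantor_measure ?E"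
    using T(1) avoid by (intro cantor.finite_measure_mono) auto
  with K(2) measure_avoid_translates[OF \<open>finite T\<close> T(2), of n] \<open>card T = H\<close>
  show False by simp
qed

text \<open>From \<open>1 - t \<le> exp (- t)\<close> the power is at most
  \<open>exp (- (2 ^ n))\<close>. Thus \<open>4 ^ n\<close> translates eventually beat any positive
  measure.\<close>

lemma power_four_power_tendsto_0: "(\<lambda>n. (1 - (1/2) ^ n :: real) ^ (4 ^ n)) \<longlonglongrightarrow> 0"
proof (rule tendsto_sandwich[of "\<lambda>_. 0" _ _ "\<lambda>n. (1/2) ^ n"])
  show "\<forall>\<^sub>F n in sequentially. (1 - (1/2) ^ n :: real) ^ (4 ^ n) \<le> (1/2) ^ n"
  proof (intro always_eventually allI)
    fix n
    have "(1 - (1/2) ^ n :: real) ^ (4 ^ n) \<le> exp (- ((1/2) ^ n)) ^ (4 ^ n)"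
      using exp_ge_add_one_self[of "- ((1/2) ^ n)"] by (intro power_mono) (auto simp: power_le_one)
    also have "\<dots> = inverse (exp (4 ^ n * (1/2) ^ n))"
      by (simp add: exp_of_nat_mult[symmetric] exp_minus[symmetric])
    also have "(4 ^ n * (1/2) ^ n :: real) = 2 ^ n"
      by (simp flip: power_mult_distrib)
    also have "inverse (exp (2 ^ n)) \<le> inverse (2 ^ n :: real)"
      using exp_ge_add_one_self[of "2 ^ n"] by (intro le_imp_inverse_le) (linarith | simp)+
    finally show "(1 - (1/2) ^ n :: real) ^ (4 ^ n) \<le> (1/2) ^ n"
      by (simp add: power_one_over inverse_eq_divide)
  qed
  show "(\<lambda>n. (1/2 :: real) ^ n) \<longlonglongrightarrow> 0" by (rule LIMSEQ_power_zero) simp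
  show "\<forall>\<^sub>F n in sequentially. (0 :: real) \<le> (1 - (1/2) ^ n) ^ (4 ^ n)"
    by (simp add: power_le_one)
qed simp

lemma cantor_diam_le:
  assumes "\<And>x y. x \<in> S \<Longrightarrow> y \<in> S \<Longrightarrow> x \<in> cylinder y h"
  shows "cantor_diam S \<le> (1/2) ^ h"
proof (cases "S = {}")
  case False
  have "cantor_dist x y \<le> (1/2) ^ h" if "x \<in> S" "y \<in> S" for x y
  proof (cases "x = y")
    case xy: False
    then have "\<exists>n. x n \<noteq> y n" by auto
    then have "x (LEAST n. x n \<noteq> y n) \<noteq> y (LEAST n. x n \<noteq> y n)" by (rule LeastI_ex)
    with assms[OF that] have "h \<le> (LEAST n. x n \<noteq> y n)"
      unfolding cylinder_def by (metis (mono_tags, lifting) mem_Collect_eq not_le_imp_less)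
    with xy show ?thesis by (simp add: cantor_dist_def power_decreasing)
  qed (simp add: cantor_dist_def)
  with False show ?thesis
    unfolding cantor_diam_def by (auto intro!: cSUP_least)
qed (simp add: cantor_diam_def)

text \<open>The level at which a piece \<open>Y j\<close> has few prefixes depends on
  \<open>f\<close>, so it is unknown when \<open>f\<close> is chosen. Coding the level
  \<open>n\<close> into the index of the covering set lets \<open>f\<close> provide for all levels
  in advance; for each \<open>n\<close> only finitely many pairs with \<open>j \<le> n\<close> and
  \<open>i < 4 ^ n\<close> matter.\<close>

lemma covered_by_few_prefixes:
  fixes Y :: "nat \<Rightarrow> cantor set"
  assumes eps: "\<And>q. \<epsilon> q > 0"
    and f: "\<And>n j i. j \<le> n \<Longrightarrow> i < 4 ^ n \<Longrightarrow>
      (1/2) ^ f n < \<epsilon> (prod_encode (n, prod_encode (j, i)))"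
    and few: "\<And>j. \<exists>n\<ge>j. finite (prefix_code (f n) ` Y j) \<and> card (prefix_code (f n) ` Y j) \<le> 4 ^ n"
  shows "\<exists>C. (\<forall>q. cantor_diam (C q) < \<epsilon> q) \<and> (\<Union>j. Y j) \<subseteq> (\<Union>q. C q)"
proof -
  obtain N where N: "\<And>j. j \<le> N j" "\<And>j. finite (prefix_code (f (N j)) ` Y j)"
    "\<And>j. card (prefix_code (f (N j)) ` Y j) \<le> 4 ^ N j"
    using few by metis
  have "\<forall>j. \<exists>g. bij_betw g {0..<card (prefix_code (f (N j)) ` Y j)} (prefix_code (f (N j)) ` Y j)"
    using N(2) ex_bij_betw_nat_finite by blast
  then obtain g where g: "\<And>j. bij_betw (g j) {0..<card (prefix_code (f (N j)) ` Y j)}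
      (prefix_code (f (N j)) ` Y j)"
    by metis
  \<comment> \<open>Only the level \<open>N j\<close> is used; all other sets are empty and have
    diameter 0. For \<open>i\<close> beyond the number of prefixes \<open>g j i\<close> is
    unspecified, but its set still has at most one prefix.\<close>
  define D where "D n j i = (if n = N j \<and> i < 4 ^ n then {x. prefix_code (f n) x = g j i} else {})"
    for n j i
  define C where "C q = (case prod_decode q of (n, r) \<Rightarrow> case prod_decode r of (j, i) \<Rightarrow> D n j i)"
    for q
  have C: "C (prod_encode (n, prod_encode (j, i))) = D n j i" for n j i
    by (simp add: C_def)
  have "cantor_diam (C q) < \<epsilon> q" for q
  proof -
    obtain n j i where q: "q = prod_encode (n, prod_encode (j, i))"
      by (metis prod_decode_inverse surj_pair)
    show ?thesis
    proof (cases "n = N j \<and> i < 4 ^ n")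
      case True
      then have "cantor_diam (C q) \<le> (1/2) ^ f n"
        unfolding q C by (intro cantor_diam_le) (auto simp: D_def simp flip: prefix_code_eq_iff split: if_splits)
      also have "\<dots> < \<epsilon> q" unfolding q using True N(1)[of j] by (intro f) auto
      finally show ?thesis .
    next
      case False
      then have "C q = {}" unfolding q C by (auto simp: D_def)
      then show ?thesis using eps by (simp add: cantor_diam_def)
    qed
  qed
  moreover have "(\<Union>j. Y j) \<subseteq> (\<Union>q. C q)"
  proof clarify
    fix x j assume "x \<in> Y j"
    then have "prefix_code (f (N j)) x \<in> g j ` {0..<card (prefix_code (f (N j)) ` Y j)}"
      using g[of j] by (simp add: bij_betw_def)
    then obtain i where "i < card (prefix_code (f (N j)) ` Y j)" "prefix_code (f (N j)) x = g j i"
      by auto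
    with N(3)[of j] have "x \<in> D (N j) j i" by (simp add: D_def)
    then show "x \<in> (\<Union>q. C q)" unfolding C[symmetric] by blast
  qed
  ultimately show ?thesis by blast
qed

lemma eventually_power_half_less:
  assumes "\<And>i. i \<in> I \<Longrightarrow> \<delta> i > (0::real)" and "finite I"
  shows "\<exists>n. \<forall>i\<in>I. (1/2) ^ n < \<delta> i"
proof -
  have "(\<lambda>n. (1/2 :: real) ^ n) \<longlonglongrightarrow> 0" by (rule LIMSEQ_power_zero) simp
  then have "\<forall>i\<in>I. \<forall>\<^sub>F n in sequentially. (1/2) ^ n < \<delta> i"
    using assms(1) order_tendstoD(2) by blast
  then have "\<forall>\<^sub>F n in sequentially. \<forall>i\<in>I. (1/2) ^ n < \<delta> i"
    using assms(2) by (simp add: eventually_ball_finite)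
  then show ?thesis unfolding eventually_sequentially by blast
qed

section \<open>Reduction to a closed set of locally positive measure\<close>

text \<open>Compare the topological support of a measure: what is removed are the cylinders that meet
  \<open>K0\<close> in a null set.\<close>

lemma closed_positive_kernel:
  assumes closed: "cantor_open (- K0)" and pos: "measure cantor_measure K0 > 0"
  obtains K where "K \<subseteq> K0" "cantor_open (- K)" "K \<noteq> {}"
    "\<And>y h. y \<in> K \<Longrightarrow> measure cantor_measure (K \<inter> cylinder y h) > 0"
proof -
  define Z where "Z = {cylinder z h | z h. measure cantor_measure (K0 \<inter> cylinder z h) = 0}"
  define K where "K = K0 - \<Union>Z"
  have K0: "K0 \<in> sets cantor_measure"
    using sets.compl_sets[OF cantor_open_sets[OF closed]] by (simp add: Compl_eq_Diff_UNIV double_diff)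
  have "(\<Union>C\<in>Z. K0 \<inter> C) \<in> null_sets cantor_measure"
  proof (rule null_sets_UN')
    show "countable Z" unfolding Z_def by (rule countable_cylinders)
    show "K0 \<inter> C \<in> null_sets cantor_measure" if "C \<in> Z" for C
      using that K0 by (auto simp: Z_def null_sets_def cantor.emeasure_eq_measure)
  qed
  then have null: "K0 \<inter> \<Union>Z \<in> null_sets cantor_measure" by (simp only: Int_Union)
  \<comment> \<open>Only a null part of \<open>K0\<close> was removed, so positivity in a cylinder
    passes from \<open>K0\<close> to \<open>K\<close>.\<close>
  have same: "measure cantor_measure (K \<inter> A) = measure cantor_measure (K0 \<inter> A)"
    if "A \<in> sets cantor_measure" for A
  proof -
    have "K \<inter> A = (K0 \<inter> A) - (K0 \<inter> \<Union>Z)" by (auto simp: K_def)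
    then show ?thesis using measure_Diff_null_set[OF _ null, of "K0 \<inter> A"] K0 that by simp
  qed
  show thesis
  proof (rule that)
    show "K \<subseteq> K0" by (auto simp: K_def)
    show "cantor_open (- K)"
      unfolding cantor_open_def
    proof
      fix z assume "z \<in> - K"
      then consider "z \<in> - K0" | C where "C \<in> Z" "z \<in> C" by (auto simp: K_def)
      then show "\<exists>h. cylinder z h \<subseteq> - K"
      proof cases
        case 1
        then show ?thesis using closed unfolding cantor_open_def K_def by blast
      next
        case 2
        then obtain z' h where "C = cylinder z' h" by (auto simp: Z_def)
        with 2 have "cylinder z h \<in> Z" using cylinder_eq[of z z' h] by simp
        then show ?thesis unfolding K_def by blast
      qed
    qed
    show "K \<noteq> {}" using same[of UNIV] pos sets.top[of cantor_measure] by auto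
    show "measure cantor_measure (K \<inter> cylinder y h) > 0" if y: "y \<in> K" for y h
    proof -
      have "cylinder y h \<notin> Z" using y self_in_cylinder unfolding K_def by blast
      then have "measure cantor_measure (K0 \<inter> cylinder y h) \<noteq> 0" unfolding Z_def by blast
      then show ?thesis unfolding same[OF sets_cylinder] zero_less_measure_iff .
    qed
  qed
qed

lemma null_additive_strong_measure_zero:
  assumes X: "X \<in> null_additive"
  shows "X \<in> strong_measure_zero"
  unfolding strong_measure_zero_def
proof (intro CollectI allI impI)
  fix \<epsilon> :: "nat \<Rightarrow> real" assume eps: "\<forall>n. \<epsilon> n > 0"
  \<comment> \<open>\<open>f\<close> is fixed from the prescribed diameters alone, before
    null-additivity is applied to the null set built from it.\<close>
  have "\<exists>h. \<forall>(j, i)\<in>{..n} \<times> {..<4 ^ n}. (1/2) ^ h < \<epsilon> (prod_encode (n, prod_encode (j, i)))" for n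
    using eventually_power_half_less[of "{..n} \<times> {..<4 ^ n}"
        "\<lambda>(j, i). \<epsilon> (prod_encode (n, prod_encode (j, i)))"] eps
    by (auto simp: case_prod_beta)
  then obtain f where f: "\<And>n. \<forall>(j, i)\<in>{..n} \<times> {..<4 ^ n}.
      (1/2) ^ f n < \<epsilon> (prod_encode (n, prod_encode (j, i)))" by metis
  define N where "N = (\<Inter>m. \<Union>n\<in>{m..}. zero_block_set (f n) n)"
  have "N \<in> lebesgue_null" unfolding N_def by (rule lebesgue_nullI[OF limsup_zero_block_null])
  then have "{cantor_add x y | x y. x \<in> X \<and> y \<in> N} \<in> lebesgue_null"
    using X unfolding null_additive_def by blast
  then obtain V where V: "{cantor_add x y | x y. x \<in> X \<and> y \<in> N} \<subseteq> V" "cantor_open V"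
    "emeasure cantor_measure V < 1" "V \<in> sets cantor_measure"
    by (rule null_open_cover[of _ 1]) simp
  have "measure cantor_measure (- V) > 0"
    using cantor.prob_compl[OF V(4)] V(3)
    by (simp add: Compl_eq_Diff_UNIV cantor.emeasure_eq_measure)
  then obtain K where K: "K \<subseteq> - V" "cantor_open (- K)" "K \<noteq> {}"
    "\<And>y h. y \<in> K \<Longrightarrow> measure cantor_measure (K \<inter> cylinder y h) > 0"
    using closed_positive_kernel[of "- V"] V(2) by auto
  \<comment> \<open>Relatively open parts of \<open>K\<close> indexed by lists, so that the pieces
    of \<open>X\<close> below form a countable family.\<close>
  define L where "L l = K \<inter> {y. map y [0..<length l] = l}" for l
  have K_sets: "K \<in> sets cantor_measure"
    using sets.compl_sets[OF cantor_open_sets[OF K(2)]] by (simp add: Compl_eq_Diff_UNIV double_diff)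
  have L_sets: "L l \<in> sets cantor_measure" for l
  proof -
    have "{y. map y [0..<length l] = l} = cylinder (nth l) (length l)"
      by (rule cylinder_eq_list[symmetric]) (rule map_nth[symmetric])
    then show ?thesis
      unfolding L_def using sets.Int[OF K_sets sets_cylinder] by (simp only:)
  qed
  \<comment> \<open>Pieces attached to a null part of \<open>K\<close> are made empty, since
    \<open>few_prefixes\<close> says nothing about them.\<close>
  define Y where "Y p = (case p of (l, m) \<Rightarrow>
      if measure cantor_measure (L l) > 0
      then {x \<in> X. \<forall>y\<in>L l. \<forall>n\<ge>m. cantor_add x y \<notin> zero_block_set (f n) n} else {})"
    for p :: "bool list \<times> nat"
  have "\<exists>p. x \<in> Y p" if x: "x \<in> X" for x
  proof -
    let ?U = "\<lambda>m. \<Union>n\<in>{m..}. cantor_add x -` zero_block_set (f n) n"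
    have opn: "cantor_open (?U m)" for m
      by (intro cantor_open_UN cantor_open_zero_block)
    \<comment> \<open>For a common point \<open>y\<close>, the sum of \<open>x\<close> and
      \<open>y\<close> would lie in \<open>N\<close>; adding \<open>x\<close> again returns
      \<open>y\<close>, which would then lie in \<open>V\<close>.\<close>
    have "K \<inter> (\<Inter>m. ?U m) = {}"
    proof (rule ccontr)
      assume "K \<inter> (\<Inter>m. ?U m) \<noteq> {}"
      then obtain y where y: "y \<in> K" "y \<in> (\<Inter>m. ?U m)" by blast
      then have "cantor_add x y \<in> N" by (auto simp: N_def)
      then have "cantor_add x (cantor_add x y) \<in> V" using x V(1) by blast
      with y(1) K(1) show False by auto
    qed
    \<comment> \<open>By Baire some \<open>?U m\<close> fails to be dense in \<open>K\<close>: it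
      misses a nonempty relatively open part, of positive measure by the choice of
      \<open>K\<close>.\<close>
    then have "\<not> (\<forall>y\<in>K. \<forall>h m. K \<inter> cylinder y h \<inter> ?U m \<noteq> {})"
      using cantor_baire[OF K(2,3), of ?U] opn by blast
    then obtain y h m where y: "y \<in> K" "K \<inter> cylinder y h \<inter> ?U m = {}"
      by blast
    have L: "L (map y [0..<h]) = K \<inter> cylinder y h"
      unfolding L_def using cylinder_eq_list[OF refl, of y h] by simp
    have "\<forall>y'\<in>L (map y [0..<h]). \<forall>n\<ge>m. cantor_add x y' \<notin> zero_block_set (f n) n"
      unfolding L using y(2) by blast
    moreover have "measure cantor_measure (L (map y [0..<h])) > 0"
      unfolding L by (rule K(4)[OF y(1)])
    ultimately have "x \<in> Y (map y [0..<h], m)"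
      using x unfolding Y_def by simp
    then show ?thesis ..
  qed
  then have cover: "X \<subseteq> (\<Union>j. Y (from_nat j))"
  proof (intro subsetI)
    fix x assume "x \<in> X"
    then obtain p where "x \<in> Y p" using \<open>\<And>x. x \<in> X \<Longrightarrow> \<exists>p. x \<in> Y p\<close> by blast
    then show "x \<in> (\<Union>j. Y (from_nat j))" by (intro UN_I[of "to_nat p"]) simp_all
  qed
  have few: "\<exists>n\<ge>j. finite (prefix_code (f n) ` Y p) \<and> card (prefix_code (f n) ` Y p) \<le> 4 ^ n"
    for j p
  proof -
    obtain l m where p: "p = (l, m)" by (cases p)
    show ?thesis
    proof (cases "measure cantor_measure (L l) > 0")
      case True
      then have "\<forall>\<^sub>F n in sequentially. (1 - (1/2) ^ n) ^ (4 ^ n) < measure cantor_measure (L l)"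
        by (rule order_tendstoD(2)[OF power_four_power_tendsto_0])
      \<comment> \<open>The level must pass \<open>m\<close> for the avoidance to hold and
        \<open>j\<close> for \<open>covered_by_few_prefixes\<close>.\<close>
      then have "\<forall>\<^sub>F n in sequentially. (1 - (1/2) ^ n) ^ (4 ^ n) < measure cantor_measure (L l)
          \<and> j \<le> n \<and> m \<le> n"
        by (intro eventually_conj eventually_ge_at_top)
      then obtain n where n: "(1 - (1/2) ^ n) ^ (4 ^ n) < measure cantor_measure (L l)"
          "j \<le> n" "m \<le> n"
        unfolding eventually_sequentially by blast
      have "finite (prefix_code (f n) ` Y p) \<and> card (prefix_code (f n) ` Y p) \<le> 4 ^ n"
        by (rule few_prefixes[OF L_sets n(1)]) (use n True in \<open>auto simp: Y_def p\<close>)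
      with n(2) show ?thesis by blast
    qed (auto simp: Y_def p)
  qed
  have "\<exists>C. (\<forall>q. cantor_diam (C q) < \<epsilon> q) \<and> (\<Union>j. Y (from_nat j)) \<subseteq> (\<Union>q. C q)"
    by (rule covered_by_few_prefixes[where f = f]) (use eps f few in auto)
  with cover show "\<exists>C. (\<forall>n. cantor_diam (C n) < \<epsilon> n) \<and> X \<subseteq> (\<Union>n. C n)"
    by (meson order_trans)
qed

theorem theorem7p2:
  assumes "GP_all"
  shows "strong_measure_zero = null_additive"
  using GP_all_strong_measure_zero_null_additive[OF assms] null_additive_strong_measure_zero
  by blast

end
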